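(* For every positive integer $n$, $\lceil n/6\rceil\le ub(K_n)\le \lceil (n+4)/6\rceil$.
   Context: $K_n$ is the complete graph on $n$ vertices. A bar is a closed horizontal line segment of length $1$ in the plane. Two bars of an arrangement of pairwise disjoint bars see each other if there is an axis-parallel rectangle of positive width whose bottom side lies in one of them, whose top side lies in the other, and whose interior meets no bar of the arrangement. For a nonnegative integer $t$, a $t$-unit-bar visibility representation of a graph $G$ assigns to each vertex a set of at most $t$ bars, all bars pairwise disjoint, such that two distinct vertices are adjacent iff some bar of one sees some bar of the other; $ub(G)$ is the minimum such $t$.
   Formalization: Each vertex is required to be assigned at least one bar (a nonempty set of at most t bars); with empty sets allowed, ub(K_1)=0 and the lower bound fails at n=1, while for n≥2 the value of ub(K_n) is unchanged. *)

theory Defs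
  imports "HOL-Analysis.Analysis" "Graph_Theory.Kuratowski"
begin

definition is_bar :: "(real \<times> real) set \<Rightarrow> bool" where
  "is_bar B \<longleftrightarrow> (\<exists>x y. B = {x..x + 1} \<times> {y})"

definition sees :: "(real \<times> real) set set \<Rightarrow> (real \<times> real) set \<Rightarrow> (real \<times> real) set \<Rightarrow> bool" where
  "sees \<A> B C \<longleftrightarrow>
     (\<exists>a b c d. a < b \<and> c < d \<and>
        ({a..b} \<times> {c} \<subseteq> B \<and> {a..b} \<times> {d} \<subseteq> C \<or>
         {a..b} \<times> {c} \<subseteq> C \<and> {a..b} \<times> {d} \<subseteq> B) \<and>
        (\<forall>D\<in>\<A>. interior ({a..b} \<times> {c..d}) \<inter> D = {}))"

text \<open>
  Graphs are symmetric loopless digraphs, so \<open>u \<rightarrow>\<^bsub>G\<^esub> v\<close> is undirected adjacency.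
  The disjointness condition is on the family indexed by pairs (vertex, bar), so distinct
  vertices cannot share a bar. Every vertex is represented by at least one bar. This matters
  only for graphs without edges: if empty sets were allowed, a single vertex would have a
  representation with \<open>t = 0\<close>.
\<close>

definition unit_bar_visibility_rep ::
    "nat \<Rightarrow> ('a,'b) pre_digraph \<Rightarrow> ('a \<Rightarrow> (real \<times> real) set set) \<Rightarrow> bool" where
  "unit_bar_visibility_rep t G R \<longleftrightarrow>
     (\<forall>v\<in>verts G. R v \<noteq> {} \<and> finite (R v) \<and> card (R v) \<le> t \<and> (\<forall>B\<in>R v. is_bar B)) \<and>
     disjoint_family_on snd (SIGMA v:verts G. R v) \<and>
     (\<forall>u\<in>verts G. \<forall>v\<in>verts G. u \<noteq> v \<longrightarrow>
        (u \<rightarrow>\<^bsub>G\<^esub> v \<longleftrightarrow> (\<exists>B\<in>R u. \<exists>C\<in>R v. sees (\<Union>w\<in>verts G. R w) B C)))"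

definition ub :: "('a,'b) pre_digraph \<Rightarrow> nat" where
  "ub G = (LEAST t. \<exists>R. unit_bar_visibility_rep t G R)"

end

theory Submission
  imports Defs
begin

text \<open>
  Lower bound: widen a line of sight between two bars to the left as far as possible. It stops at
  the left end of the lower bar, at the left end of the upper bar, or at the right end of a bar
  in between. The stopping bar together with the kind of stop determines the pair, and the
  highest bar is never a stopping lower bar. So \<open>N\<close> bars have fewer than \<open>3 * N\<close> visible pairs,
  while \<open>K\<^sub>n\<close> with \<open>N \<le> n * t\<close> requires \<open>n * (n - 1) / 2\<close>.

  Upper bound: it suffices to represent \<open>K\<^sub>n\<close> for \<open>n = 6 * p + 2\<close> with \<open>p + 1\<close> bars per vertex.
  Identify the vertices with the residues modulo \<open>M = 6 * p - 1\<close> and three extra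
  vertices \<open>a\<close>, \<open>b\<close>, \<open>c\<close>, and stack all bars with tiny horizontal offsets. Then two bars see each
  other as soon as all bars between them are offset further to the right, or all further to
  the left, than both of them. The main part of the stack is \<open>A\<^sub>0, C\<^sub>0, A\<^sub>1, C\<^sub>1, \<dots>\<close>, where the single
  bars \<open>A\<^sub>i\<close> (labelled \<open>i\<close>) are alternately far right and far left, and the bars of \<open>C\<^sub>i\<close> (labelled
  \<open>i + d\<close> for \<open>d = 5, 8, \<dots>, 3 * p - 1\<close> in zigzag order) form a staircase in the middle that leads away
  from \<open>A\<^sub>i\<close>. Both \<open>A\<^sub>i\<close> and \<open>A\<^sub>i\<^sub>+\<^sub>1\<close> see all of \<open>C\<^sub>i\<close>, which yields the label differences \<open>d\<close> and \<open>d - 1\<close>;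
  consecutive bars of \<open>C\<^sub>i\<close> yield \<open>3, 6, \<dots>, 3 * (p - 2)\<close>; the top bar of \<open>C\<^sub>i\<close> sees \<open>A\<^sub>i\<^sub>+\<^sub>2\<close>, which
  yields \<open>3 * (p - 1)\<close>; and \<open>A\<^sub>i\<close> sees \<open>A\<^sub>i\<^sub>+\<^sub>2\<close>. Of the differences up to \<open>(M - 1) / 2\<close> only 1 is
  missing. It comes from a final staircase that carries every label once more and is seen as a
  whole by \<open>b\<close> from the left and by \<open>c\<close> from the right. Its first two bars serve
  as \<open>A\<^sub>M\<close> and \<open>A\<^bsub>M+1\<^esub>\<close>, and its last bar is so far to the left that it sees the first one past all
  others, which closes the cycle of differences 1. Only the label 0 is hidden from \<open>c\<close> there, so a
  second bar of \<open>c\<close> is put right below \<open>A\<^sub>0\<close>. Two bars of \<open>a\<close> at the very bottom see all \<open>A\<^sub>i\<close>, because the \<open>A\<^sub>i\<close> move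
  outwards with growing \<open>i\<close>.
\<close>

subsection \<open>The number of visible pairs\<close>

definition bar :: "real \<Rightarrow> real \<Rightarrow> (real \<times> real) set" where
  "bar x y = {x..x + 1} \<times> {y}"

lemma is_bar_iff: "is_bar B \<longleftrightarrow> (\<exists>x y. B = bar x y)"
  by (simp add: is_bar_def bar_def)

lemma mem_bar [simp]: "(s, t) \<in> bar x y \<longleftrightarrow> x \<le> s \<and> s \<le> x + 1 \<and> t = y"
  by (auto simp: bar_def)

lemma interior_rectangle:
  "interior ({a..b} \<times> {c..d}) = {a<..<b} \<times> {c<..<(d::real)}" for a b :: real
  by (simp add: interior_Times)

lemma sees_commute: "sees \<A> B C \<longleftrightarrow> sees \<A> C B"
  unfolding sees_def by blast

lemma sees_mono: "sees \<A> B C \<Longrightarrow> \<B> \<subseteq> \<A> \<Longrightarrow> sees \<B> B C"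
  unfolding sees_def by (meson subsetD)

lemma disjoint_open_rectangle_bar_iff:
  assumes "a < b" "c < d"
  shows "({a<..<b} \<times> {c<..<d}) \<inter> bar x y = {} \<longleftrightarrow> (c < y \<and> y < d \<longrightarrow> x + 1 \<le> a \<or> b \<le> x)"
proof -
  have "\<exists>s. a < s \<and> s < b \<and> x \<le> s \<and> s \<le> x + 1" if "a < x + 1" "x < b"
  proof -
    have "max a x < min b (x + 1)"
      using assms that by simp
    then obtain s where "max a x < s" "s < min b (x + 1)"
      using dense by blast
    then show ?thesis
      by (intro exI[of _ s]) auto
  qed
  then show ?thesis
    by (fastforce simp: bar_def)
qed

lemma segment_subset_bar_iff:
  assumes "a < b"
  shows "{a..b} \<times> {c} \<subseteq> bar x y \<longleftrightarrow> x \<le> a \<and> b \<le> x + 1 \<and> c = y"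
proof
  assume sub: "{a..b} \<times> {c} \<subseteq> bar x y"
  have "(a, c) \<in> {a..b} \<times> {c}" "(b, c) \<in> {a..b} \<times> {c}"
    using assms by auto
  with sub have "(a, c) \<in> bar x y" "(b, c) \<in> bar x y"
    by blast+
  then show "x \<le> a \<and> b \<le> x + 1 \<and> c = y"
    by simp
qed (auto simp: bar_def)

section \<open>Lines of sight as corridors\<close>

text \<open>Visibility in coordinates: \<open>x\<close> and \<open>y\<close> stand for the left end
  and the height of a bar. \<open>B\<close> is always the lower bar, so corridors join oriented
  pairs.\<close>

definition corridor ::
    "(real \<times> real) set set \<Rightarrow> ((real \<times> real) set \<Rightarrow> real) \<Rightarrow> ((real \<times> real) set \<Rightarrow> real) \<Rightarrow>
     real \<Rightarrow> real \<Rightarrow> (real \<times> real) set \<Rightarrow> (real \<times> real) set \<Rightarrow> bool" where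
  "corridor \<A> x y a b B C \<longleftrightarrow>
     a < b \<and> y B < y C \<and> x B \<le> a \<and> b \<le> x B + 1 \<and> x C \<le> a \<and> b \<le> x C + 1 \<and>
     (\<forall>D\<in>\<A>. y B < y D \<and> y D < y C \<longrightarrow> x D + 1 \<le> a \<or> b \<le> x D)"

lemma sees_imp_corridor:
  assumes bars: "\<And>B. B \<in> \<A> \<Longrightarrow> B = bar (x B) (y B)"
    and "B \<in> \<A>" "C \<in> \<A>" "sees \<A> B C"
  shows "\<exists>a b. corridor \<A> x y a b B C \<or> corridor \<A> x y a b C B"
proof -
  obtain a b c d where ab: "a < b" "c < d"
    and s: "{a..b} \<times> {c} \<subseteq> B \<and> {a..b} \<times> {d} \<subseteq> C \<or> {a..b} \<times> {c} \<subseteq> C \<and> {a..b} \<times> {d} \<subseteq> B"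
    and free: "\<forall>D\<in>\<A>. interior ({a..b} \<times> {c..d}) \<inter> D = {}"
    using assms(4) unfolding sees_def by blast
  have free': "c < y D \<and> y D < d \<longrightarrow> x D + 1 \<le> a \<or> b \<le> x D" if "D \<in> \<A>" for D
    using free bars[OF that] that disjoint_open_rectangle_bar_iff[OF ab, of "x D" "y D"]
    by (simp add: interior_rectangle)
  have seg: "{a..b} \<times> {z} \<subseteq> D \<longleftrightarrow> x D \<le> a \<and> b \<le> x D + 1 \<and> z = y D" if "D \<in> \<A>" for D z
    using segment_subset_bar_iff[OF ab(1), of z "x D" "y D"] bars[OF that] by simp
  show ?thesis
    using s free' ab unfolding seg[OF assms(2)] seg[OF assms(3)] corridor_def by blast
qed

lemma corridor_extend_left:
  assumes "finite \<A>" and cor: "corridor \<A> x y a b B C"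
  shows "\<exists>l. corridor \<A> x y l b B C \<and>
    (l = x B \<or> l = x C \<or> (\<exists>D\<in>\<A>. l = x D + 1 \<and> y B < y D \<and> y D < y C))"
proof -
  \<comment> \<open>The places up to \<open>a\<close> where widening to the left can stop; the best
    new left side is the largest of them.\<close>
  define S where "S = {x B, x C} \<union> (\<lambda>D. x D + 1) ` {D \<in> \<A>. y B < y D \<and> y D < y C \<and> x D + 1 \<le> a}"
  have S: "finite S" "S \<noteq> {}" "\<forall>s\<in>S. s \<le> a"
    using assms by (auto simp: S_def corridor_def)
  have mem: "x B \<in> S" "x C \<in> S"
    by (simp_all add: S_def)
  have le: "Max S \<le> a" "x B \<le> Max S" "x C \<le> Max S"
    using S mem by simp_all
  have "corridor \<A> x y (Max S) b B C"
    unfolding corridor_def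
  proof (intro conjI ballI impI)
    fix D assume D: "D \<in> \<A>" "y B < y D \<and> y D < y C"
    then have "x D + 1 \<le> a \<or> b \<le> x D"
      using cor by (auto simp: corridor_def)
    moreover have "x D + 1 \<le> Max S" if "x D + 1 \<le> a"
      using S(1) D that by (intro Max_ge) (auto simp: S_def)
    ultimately show "x D + 1 \<le> Max S \<or> b \<le> x D"
      by blast
  qed (use cor le in \<open>auto simp: corridor_def\<close>)
  moreover have "Max S \<in> S"
    using S by simp
  ultimately show ?thesis
    unfolding S_def by blast
qed

text \<open>If the lower bars had different heights, the higher one would lie strictly inside the
  other corridor and block it just right of \<open>l\<close>; likewise for the upper bars. So the
  heights agree, and disjoint bars of equal height cannot share the point at
  \<open>l\<close>.\<close>

lemma corridor_unique:
  assumes bars: "\<And>B. B \<in> \<A> \<Longrightarrow> B = bar (x B) (y B)"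
    and disj: "\<And>B C. B \<in> \<A> \<Longrightarrow> C \<in> \<A> \<Longrightarrow> B \<noteq> C \<Longrightarrow> B \<inter> C = {}"
    and mem: "B \<in> \<A>" "C \<in> \<A>" "B' \<in> \<A>" "C' \<in> \<A>"
    and cor: "corridor \<A> x y l b B C" "corridor \<A> x y l b' B' C'"
    and overlap: "y B < y C'" "y B' < y C"
  shows "B = B' \<and> C = C'"
proof -
  have eqI: "D = D'" if D: "D \<in> \<A>" "D' \<in> \<A>" "y D = y D'"
    "x D \<le> l" "l \<le> x D + 1" "x D' \<le> l" "l \<le> x D' + 1" for D D'
  proof -
    have "(l, y D) \<in> D" using bars[OF D(1)] D by (metis mem_bar)
    moreover have "(l, y D) \<in> D'" using bars[OF D(2)] D by (metis mem_bar)
    ultimately show ?thesis using disj D(1,2) by blast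
  qed
  have "\<not> y B < y B'" "\<not> y B' < y B" "\<not> y C < y C'" "\<not> y C' < y C"
    using cor mem overlap unfolding corridor_def by force+
  then have "y B = y B'" "y C = y C'"
    by auto
  then show ?thesis
    using cor mem unfolding corridor_def by (intro conjI eqI) auto
qed

lemma card_corridors_less:
  assumes "finite \<A>" "\<A> \<noteq> {}"
    and bars: "\<And>B. B \<in> \<A> \<Longrightarrow> B = bar (x B) (y B)"
    and disj: "\<And>B C. B \<in> \<A> \<Longrightarrow> C \<in> \<A> \<Longrightarrow> B \<noteq> C \<Longrightarrow> B \<inter> C = {}"
  defines "E \<equiv> {(B, C). B \<in> \<A> \<and> C \<in> \<A> \<and> (\<exists>a b. corridor \<A> x y a b B C)}"
  shows "card E < 3 * card \<A>"
proof -
  define charge where "charge B C D k \<longleftrightarrow> (\<exists>l b. corridor \<A> x y l b B C \<and>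
      (k = 0 \<and> D = B \<and> l = x B \<or> k = 1 \<and> D = C \<and> l = x C \<or>
       k = 2 \<and> l = x D + 1 \<and> y B < y D \<and> y D < y C))" for B C D and k :: nat
  have charge_less: "y B < y C" if "charge B C D k" for B C D k
    using that unfolding charge_def corridor_def by blast
  have charge_le: "k \<in> {0, 1, 2}" if "charge B C D k" for B C D k
    using that unfolding charge_def by blast
  have charge_0: "D = B" if "charge B C D 0" for B C D
    using that unfolding charge_def by auto
  have charge_unique: "B = B' \<and> C = C'"
    if mem: "B \<in> \<A>" "C \<in> \<A>" "B' \<in> \<A>" "C' \<in> \<A>"
      and charge: "charge B C D k" "charge B' C' D k" for B C B' C' D k
  proof -
    obtain l b where cor: "corridor \<A> x y l b B C"
      and k: "k = 0 \<and> D = B \<and> l = x B \<or> k = 1 \<and> D = C \<and> l = x C \<or>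
         k = 2 \<and> l = x D + 1 \<and> y B < y D \<and> y D < y C"
      using charge(1) unfolding charge_def by blast
    obtain l' b' where cor': "corridor \<A> x y l' b' B' C'"
      and k': "k = 0 \<and> D = B' \<and> l' = x B' \<or> k = 1 \<and> D = C' \<and> l' = x C' \<or>
         k = 2 \<and> l' = x D + 1 \<and> y B' < y D \<and> y D < y C'"
      using charge(2) unfolding charge_def by blast
    have "y B < y C" "y B' < y C'"
      using charge_less charge by blast+
    \<comment> \<open>The same stopping bar and kind of stop give the same \<open>l\<close>, and the
      height of \<open>D\<close> belongs to both height ranges, so these overlap.\<close>
    with k k' have *: "l = l'" "y B < y C'" "y B' < y C"
      by auto
    show ?thesis
    proof (rule corridor_unique)
      show "corridor \<A> x y l b B C" "corridor \<A> x y l b' B' C'"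
        using cor cor' *(1) by simp_all
    qed (use bars disj mem * in blast)+
  qed
  have charge_exists: "\<exists>D k. D \<in> \<A> \<and> charge B C D k" if e: "(B, C) \<in> E" for B C
  proof -
    obtain a b where mem: "B \<in> \<A>" "C \<in> \<A>" and "corridor \<A> x y a b B C"
      using e unfolding E_def by blast
    then obtain l where l: "corridor \<A> x y l b B C"
      "l = x B \<or> l = x C \<or> (\<exists>D\<in>\<A>. l = x D + 1 \<and> y B < y D \<and> y D < y C)"
      using corridor_extend_left[OF assms(1)] by blast
    from l(2) show ?thesis
    proof (elim disjE bexE)
      assume "l = x B"
      then have "charge B C B 0" unfolding charge_def using l(1) by blast
      then show ?thesis using mem by blast
    next
      assume "l = x C"
      then have "charge B C C 1" unfolding charge_def using l(1) by blast
      then show ?thesis using mem by blast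
    next
      fix D assume "D \<in> \<A>" "l = x D + 1 \<and> y B < y D \<and> y D < y C"
      moreover from this have "charge B C D 2" unfolding charge_def using l(1) by blast
      ultimately show ?thesis by blast
    qed
  qed
  define g where "g = (\<lambda>(B, C). SOME (D, k). D \<in> \<A> \<and> charge B C D k)"
  have g: "fst (g (B, C)) \<in> \<A> \<and> charge B C (fst (g (B, C))) (snd (g (B, C)))"
    if "(B, C) \<in> E" for B C
  proof -
    have "\<exists>c. (\<lambda>(D, k). D \<in> \<A> \<and> charge B C D k) c"
      using charge_exists[OF that] by auto
    from someI_ex[OF this] show ?thesis
      by (simp add: g_def case_prod_unfold)
  qed
  have E_mem: "B \<in> \<A>" "C \<in> \<A>" if "(B, C) \<in> E" for B C
    using that by (auto simp: E_def)
  have inj: "inj_on g E"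
  proof (rule inj_onI, clarify)
    fix B C B' C' assume e: "(B, C) \<in> E" "(B', C') \<in> E" "g (B, C) = g (B', C')"
    show "B = B' \<and> C = C'"
      using charge_unique[OF E_mem[OF e(1)] E_mem[OF e(2)]] g[OF e(1)] g[OF e(2)] e(3) by metis
  qed
  obtain T where T: "T \<in> \<A>" "\<And>B. B \<in> \<A> \<Longrightarrow> y B \<le> y T"
  proof -
    have "Max (y ` \<A>) \<in> y ` \<A>"
      using assms(1,2) by simp
    then obtain T where "T \<in> \<A>" "Max (y ` \<A>) = y T"
      by blast
    moreover have "y B \<le> Max (y ` \<A>)" if "B \<in> \<A>" for B
      using that assms(1) by simp
    ultimately show ?thesis
      using that by simp
  qed
  have "g ` E \<subseteq> \<A> \<times> {0, 1, 2} - {(T, 0)}"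
  proof (rule image_subsetI, clarify)
    fix B C assume e: "(B, C) \<in> E"
    obtain D k where gD: "g (B, C) = (D, k)"
      by (metis surj_pair)
    with g[OF e] have D: "D \<in> \<A>" "charge B C D k"
      by auto
    have "y C \<le> y T"
      using T(2) E_mem[OF e] by blast
    then have "(D, k) \<noteq> (T, 0)"
      using charge_0 charge_less[OF D(2)] D(2) by force
    then show "g (B, C) \<in> \<A> \<times> {0, 1, 2} - {(T, 0)}"
      using D(1) charge_le[OF D(2)] gD by auto
  qed
  then have "card (g ` E) \<le> card (\<A> \<times> {0, 1, 2 :: nat} - {(T, 0)})"
    using assms(1) by (intro card_mono) auto
  moreover have "card (\<A> \<times> {0, 1, 2 :: nat} - {(T, 0)}) < card (\<A> \<times> {0, 1, 2 :: nat})"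
    using T(1) assms(1) by (intro card_Diff1_less) auto
  moreover have "card (\<A> \<times> {0, 1, 2 :: nat}) = 3 * card \<A>"
    by (simp add: card_cartesian_product)
  ultimately show ?thesis
    using inj by (simp add: card_image)
qed

section \<open>The lower bound\<close>

lemma rep_complete_imp_le:
  assumes "unit_bar_visibility_rep t G R" and K: "K\<^bsub>n\<^esub> G" and "n \<ge> 1"
  shows "n \<le> 6 * t"
proof -
  let ?V = "verts G"
  define \<A> where "\<A> = (\<Union>v\<in>?V. R v)"
  have V: "finite ?V" "card ?V = n" "?V \<noteq> {}"
    using K assms(3) unfolding complete_digraph_def
    by (auto intro: card_ge_0_finite)
  have R: "\<And>v. v \<in> ?V \<Longrightarrow> R v \<noteq> {}" "\<And>v. v \<in> ?V \<Longrightarrow> finite (R v)" "\<And>v. v \<in> ?V \<Longrightarrow> card (R v) \<le> t"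
      "\<And>v B. v \<in> ?V \<Longrightarrow> B \<in> R v \<Longrightarrow> is_bar B"
    and disjR: "disjoint_family_on snd (SIGMA v:?V. R v)"
    and vis: "\<And>u v. u \<in> ?V \<Longrightarrow> v \<in> ?V \<Longrightarrow> u \<noteq> v \<Longrightarrow> \<exists>B\<in>R u. \<exists>C\<in>R v. sees \<A> B C"
    using assms(1) K unfolding unit_bar_visibility_rep_def complete_digraph_def \<A>_def by auto
  have "\<forall>B\<in>\<A>. \<exists>p. B = bar (fst p) (snd p)"
    using R(4) unfolding \<A>_def is_bar_iff by fastforce
  from bchoice[OF this] obtain p where p: "\<forall>B\<in>\<A>. B = bar (fst (p B)) (snd (p B))" ..
  define x where "x = (\<lambda>B. fst (p B))"
  define y where "y = (\<lambda>B. snd (p B))"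
  have bars: "B = bar (x B) (y B)" if "B \<in> \<A>" for B
    unfolding x_def y_def using p that by (rule bspec)
  have nonempty: "B \<noteq> {}" if "B \<in> \<A>" for B
    by (subst bars[OF that]) (auto simp: bar_def)
  have disj: "B \<inter> C = {}" if "u \<in> ?V" "v \<in> ?V" "B \<in> R u" "C \<in> R v" "(u, B) \<noteq> (v, C)" for u v B C
    using disjR that unfolding disjoint_family_on_def by (metis SigmaI snd_conv)
  have \<A>: "finite \<A>" "\<A> \<noteq> {}"
    using V R(1,2) by (auto simp: \<A>_def)
  have "card \<A> \<le> (\<Sum>v\<in>?V. card (R v))"
    unfolding \<A>_def by (rule card_UN_le[OF V(1)])
  also have "\<dots> \<le> n * t"
    using sum_bounded_above[of ?V "\<lambda>v. card (R v)" t] R(3) V(2) by simp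
  finally have card_\<A>: "card \<A> \<le> n * t" .
  \<comment> \<open>A bar shared by two vertices would be disjoint from itself, hence empty.\<close>
  have owner_unique: "u = v" if "u \<in> ?V" "v \<in> ?V" "B \<in> R u" "B \<in> R v" for u v B
    using disj[OF that] nonempty[of B] that by (auto simp: \<A>_def)
  define owner where "owner = (\<lambda>B. THE v. v \<in> ?V \<and> B \<in> R v)"
  have owner: "owner B = v" if "v \<in> ?V" "B \<in> R v" for v B
    unfolding owner_def using that owner_unique by (intro the_equality) blast+
  define E where "E = {(B, C). B \<in> \<A> \<and> C \<in> \<A> \<and> (\<exists>a b. corridor \<A> x y a b B C)}"
  have finE: "finite E"
    by (rule finite_subset[of _ "\<A> \<times> \<A>"]) (use \<A>(1) in \<open>auto simp: E_def\<close>)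
  have "card E < 3 * card \<A>"
    unfolding E_def
  proof (rule card_corridors_less[OF \<A> bars])
    fix B C assume "B \<in> \<A>" "C \<in> \<A>" "B \<noteq> C"
    then show "B \<inter> C = {}"
      using disj unfolding \<A>_def by blast
  qed
  moreover have "n * (n - 1) \<le> 2 * card E"
  proof -
    \<comment> \<open>Each corridor accounts for at most two ordered pairs of vertices, one for each
      order of the owners.\<close>
    let ?f = "\<lambda>(B, C). (owner B, owner C)" and ?g = "\<lambda>(B, C). (owner C, owner B)"
    have "?V \<times> ?V - Id_on ?V \<subseteq> ?f ` E \<union> ?g ` E"
    proof (clarify)
      fix u v assume uv: "u \<in> ?V" "v \<in> ?V" "(u, v) \<notin> Id_on ?V" "(u, v) \<notin> ?g ` E"
      then obtain B C where BC: "B \<in> R u" "C \<in> R v" "sees \<A> B C"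
        using vis by blast
      then have mem: "B \<in> \<A>" "C \<in> \<A>"
        using uv by (auto simp: \<A>_def)
      have own: "owner B = u" "owner C = v"
        using owner uv BC by blast+
      have "(B, C) \<in> E \<or> (C, B) \<in> E"
        using sees_imp_corridor[OF bars mem BC(3)] mem unfolding E_def by blast
      moreover have "(C, B) \<notin> E"
        using uv(4) own by force
      ultimately show "(u, v) \<in> ?f ` E"
        using own by force
    qed
    then have "card (?V \<times> ?V - Id_on ?V) \<le> card (?f ` E \<union> ?g ` E)"
      using finE by (intro card_mono) auto
    also have "\<dots> \<le> card (?f ` E) + card (?g ` E)"
      by (rule card_Un_le)
    also have "\<dots> \<le> 2 * card E"
      using card_image_le[OF finE, of ?f] card_image_le[OF finE, of ?g] by linarith
    moreover have "card (?V \<times> ?V - Id_on ?V) = n * n - n"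
    proof -
      have "Id_on ?V = (\<lambda>v. (v, v)) ` ?V"
        by auto
      then have "card (Id_on ?V) = n"
        using V(2) by (simp add: card_image inj_on_def)
      moreover have "Id_on ?V \<subseteq> ?V \<times> ?V"
        by auto
      ultimately show ?thesis
        using V by (simp add: card_Diff_subset finite_subset[of "Id_on ?V" "?V \<times> ?V"] card_cartesian_product)
    qed
    ultimately show ?thesis
      by (simp add: algebra_simps)
  qed
  ultimately have "n * (n - 1) < n * (6 * t)"
    using card_\<A> by (simp add: algebra_simps)
  then have "n - 1 < 6 * t"
    by simp
  then show ?thesis
    by linarith
qed

subsection \<open>Stacks of nearly aligned bars\<close>

text \<open>Offsets of at most 1/4 make all bars overlap. If the bars in between start to the right
  of both, a strip beginning at the larger of the two left ends is free; the other case is its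
  mirror image, a strip ending at the smaller right end.\<close>

lemma sees_stacked_bars:
  fixes X h :: "'i \<Rightarrow> real"
  assumes "finite Y" and small: "\<And>i. i \<in> Y \<Longrightarrow> \<bar>X i\<bar> \<le> 1 / 4"
    and jk: "j \<in> Y" "k \<in> Y" "h j < h k"
    and clear: "(\<forall>i\<in>Y. h j < h i \<and> h i < h k \<longrightarrow> max (X j) (X k) < X i) \<or>
      (\<forall>i\<in>Y. h j < h i \<and> h i < h k \<longrightarrow> X i < min (X j) (X k))"
  shows "sees ((\<lambda>i. bar (X i) (h i)) ` Y) (bar (X j) (h j)) (bar (X k) (h k))"
proof -
  let ?I = "{i \<in> Y. h j < h i \<and> h i < h k}"
  have sees: ?thesis
    if ab: "a < b" "X j \<le> a" "b \<le> X j + 1" "X k \<le> a" "b \<le> X k + 1"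
      and free: "\<And>i. i \<in> ?I \<Longrightarrow> X i + 1 \<le> a \<or> b \<le> X i" for a b
    unfolding sees_def
  proof (intro exI conjI ballI)
    show "a < b" "h j < h k"
      by fact+
    show "{a..b} \<times> {h j} \<subseteq> bar (X j) (h j) \<and> {a..b} \<times> {h k} \<subseteq> bar (X k) (h k) \<or>
          {a..b} \<times> {h j} \<subseteq> bar (X k) (h k) \<and> {a..b} \<times> {h k} \<subseteq> bar (X j) (h j)"
      using ab by (simp add: segment_subset_bar_iff)
    fix D assume "D \<in> (\<lambda>i. bar (X i) (h i)) ` Y"
    then obtain i where "i \<in> Y" "D = bar (X i) (h i)"
      by blast
    then show "interior ({a..b} \<times> {h j..h k}) \<inter> D = {}"
      using disjoint_open_rectangle_bar_iff[OF ab(1) jk(3)] free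
      by (simp add: interior_rectangle)
  qed
  have small_jk: "\<bar>X j\<bar> \<le> 1 / 4" "\<bar>X k\<bar> \<le> 1 / 4"
    using small jk by auto
  have fin: "finite ?I"
    using assms(1) by simp
  from clear show ?thesis
  proof
    assume *: "\<forall>i\<in>Y. h j < h i \<and> h i < h k \<longrightarrow> max (X j) (X k) < X i"
    \<comment> \<open>The value 1/2 serves when nothing lies in between: it is beyond both left ends
      and still before both right ends.\<close>
    define m where "m = Min (insert (1 / 2) (X ` ?I))"
    have "m \<le> t" if "t \<in> insert (1 / 2) (X ` ?I)" for t
      unfolding m_def using that fin by (intro Min_le) auto
    then have "m \<le> 1 / 2" "\<And>i. i \<in> ?I \<Longrightarrow> m \<le> X i"
      by blast+
    moreover have "max (X j) (X k) < m"
      unfolding m_def using fin small_jk * by (subst Min_gr_iff) auto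
    ultimately show ?thesis
      using small_jk by (intro sees[of "max (X j) (X k)" m]) auto
  next
    assume *: "\<forall>i\<in>Y. h j < h i \<and> h i < h k \<longrightarrow> X i < min (X j) (X k)"
    define m where "m = Max (insert (-1 / 2) (X ` ?I))"
    have "t \<le> m" if "t \<in> insert (-1 / 2) (X ` ?I)" for t
      unfolding m_def using that fin by (intro Max_ge) auto
    then have "-1 / 2 \<le> m" "\<And>i. i \<in> ?I \<Longrightarrow> X i \<le> m"
      by blast+
    moreover have "m < min (X j) (X k)"
      unfolding m_def using fin small_jk * by (subst Max_less_iff) auto
    ultimately show ?thesis
      using small_jk by (intro sees[of "m + 1" "min (X j) (X k) + 1"]) auto
  qed
qed

text \<open>Only the order of offsets and heights matters, so integers suffice; scaling produces the
  real coordinates later.\<close>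

definition unobstructed :: "'i set \<Rightarrow> ('i \<Rightarrow> int) \<Rightarrow> ('i \<Rightarrow> int) \<Rightarrow> 'i \<Rightarrow> 'i \<Rightarrow> bool" where
  "unobstructed Y X h j k \<longleftrightarrow> j \<in> Y \<and> k \<in> Y \<and> h j < h k \<and>
     ((\<forall>i\<in>Y. h j < h i \<and> h i < h k \<longrightarrow> max (X j) (X k) < X i) \<or>
      (\<forall>i\<in>Y. h j < h i \<and> h i < h k \<longrightarrow> X i < min (X j) (X k)))"

definition linked :: "'i set \<Rightarrow> ('i \<Rightarrow> int) \<Rightarrow> ('i \<Rightarrow> int) \<Rightarrow> ('i \<Rightarrow> 'l) \<Rightarrow> 'l \<Rightarrow> 'l \<Rightarrow> bool" where
  "linked Y X h lab u v \<longleftrightarrow> (\<exists>j k. (lab j = u \<and> lab k = v \<or> lab j = v \<and> lab k = u) \<and> unobstructed Y X h j k)"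

lemma linked_commute: "linked Y X h lab u v \<Longrightarrow> linked Y X h lab v u"
  unfolding linked_def by blast

lemma complete_rep_of_stack:
  fixes G :: "('a, 'b) pre_digraph" and X h :: "'i \<Rightarrow> int" and f :: "'a \<Rightarrow> 'l"
  assumes K: "K\<^bsub>n\<^esub> G" and Y: "finite Y" "inj_on h Y"
    and f: "inj_on f (verts G)"
    and labelled: "\<And>v. v \<in> verts G \<Longrightarrow> f v \<in> lab ` Y"
    and few: "\<And>v. v \<in> verts G \<Longrightarrow> card {i \<in> Y. lab i = f v} \<le> t"
    and linked: "\<And>u v. u \<in> verts G \<Longrightarrow> v \<in> verts G \<Longrightarrow> u \<noteq> v \<Longrightarrow> linked Y X h lab (f u) (f v)"
  shows "\<exists>R. unit_bar_visibility_rep t G R"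
proof -
  obtain W :: int where W: "W > 0" "\<And>i. i \<in> Y \<Longrightarrow> \<bar>X i\<bar> \<le> W"
  proof -
    let ?W = "Max (insert 1 ((\<lambda>i. \<bar>X i\<bar>) ` Y))"
    have "1 \<le> ?W" "\<And>i. i \<in> Y \<Longrightarrow> \<bar>X i\<bar> \<le> ?W"
      using Y(1) by (auto intro: Max_ge)
    then show ?thesis
      using that[of ?W] by simp
  qed
  define x where "x = (\<lambda>i. real_of_int (X i) / (4 * W))"
  define y where "y = (\<lambda>i. real_of_int (h i))"
  define B where "B = (\<lambda>i. bar (x i) (y i))"
  have x: "x i < x j \<longleftrightarrow> X i < X j" for i j
    using W(1) by (simp add: x_def divide_less_cancel)
  have small: "\<bar>x i\<bar> \<le> 1 / 4" if "i \<in> Y" for i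
  proof -
    have "real_of_int \<bar>X i\<bar> \<le> W"
      using W(2)[OF that] by linarith
    then show ?thesis
      using W(1) by (simp add: x_def abs_mult field_simps)
  qed
  define R where "R = (\<lambda>v. B ` {i \<in> Y. lab i = f v})"
  \<comment> \<open>Bars whose label is not a value of \<open>f\<close> are dropped. This can only
    open lines of sight, so one stack serves smaller graphs too.\<close>
  have R_sub: "(\<Union>v\<in>verts G. R v) \<subseteq> B ` Y"
    by (auto simp: R_def)
  have sees: "sees (B ` Y) (B j) (B k)" if "unobstructed Y X h j k" for j k
    unfolding B_def using that small
    by (intro sees_stacked_bars[OF Y(1)])
       (auto simp: unobstructed_def x y_def)
  have vis: "\<exists>B\<in>R u. \<exists>C\<in>R v. sees (\<Union>w\<in>verts G. R w) B C"
    if uv: "u \<in> verts G" "v \<in> verts G" "u \<noteq> v" for u v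
  proof -
    obtain j k where jk: "lab j = f u \<and> lab k = f v \<or> lab j = f v \<and> lab k = f u" "unobstructed Y X h j k"
      using linked[OF uv] unfolding linked_def by blast
    have mem: "j \<in> Y" "k \<in> Y"
      using jk(2) by (simp_all add: unobstructed_def)
    have "sees (\<Union>w\<in>verts G. R w) (B j) (B k)" "sees (\<Union>w\<in>verts G. R w) (B k) (B j)"
      using sees_mono[OF sees[OF jk(2)] R_sub] sees_commute by blast+
    moreover have "B j \<in> R u \<and> B k \<in> R v \<or> B j \<in> R v \<and> B k \<in> R u"
      using jk(1) mem by (auto simp: R_def)
    ultimately show ?thesis
      by blast
  qed
  have disj: "disjoint_family_on snd (SIGMA v:verts G. R v)"
    unfolding disjoint_family_on_def
  proof (intro ballI impI)
    fix c d assume cd: "c \<in> (SIGMA v:verts G. R v)" "d \<in> (SIGMA v:verts G. R v)" "c \<noteq> d"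
    obtain u C v D where eq: "c = (u, C)" "d = (v, D)"
      by (metis surj_pair)
    have uv: "u \<in> verts G" "v \<in> verts G" "C \<in> R u" "D \<in> R v" and ne: "\<not> (u = v \<and> C = D)"
      using cd by (auto simp: eq)
    obtain i j where ij: "i \<in> Y" "lab i = f u" "C = B i" "j \<in> Y" "lab j = f v" "D = B j"
      using uv by (auto simp: R_def)
    have "i \<noteq> j"
      using ij ne f uv(1,2) by (auto dest: inj_onD)
    then have "y i \<noteq> y j"
      using Y(2) ij by (auto simp: y_def dest: inj_onD)
    then show "snd c \<inter> snd d = {}"
      unfolding ij eq by (auto simp: B_def bar_def)
  qed
  have bars: "R v \<noteq> {} \<and> finite (R v) \<and> card (R v) \<le> t \<and> (\<forall>B\<in>R v. is_bar B)"
    if v: "v \<in> verts G" for v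
  proof (intro conjI ballI)
    show "R v \<noteq> {}"
      using labelled[OF v] by (auto simp: R_def)
    show "finite (R v)"
      using Y(1) by (simp add: R_def)
    have "card (R v) \<le> card {i \<in> Y. lab i = f v}"
      unfolding R_def using Y(1) by (intro card_image_le) simp
    then show "card (R v) \<le> t"
      using few[OF v] by simp
    show "is_bar C" if "C \<in> R v" for C
      using that by (auto simp: R_def B_def is_bar_iff)
  qed
  have adjacent: "u \<rightarrow>\<^bsub>G\<^esub> v" if "u \<in> verts G" "v \<in> verts G" "u \<noteq> v" for u v
    using K that by (simp add: complete_digraph_def)
  have "unit_bar_visibility_rep t G R"
    unfolding unit_bar_visibility_rep_def
  proof (intro conjI[OF _ conjI[OF disj]] ballI impI)
    show "u \<rightarrow>\<^bsub>G\<^esub> v \<longleftrightarrow> (\<exists>B\<in>R u. \<exists>C\<in>R v. sees (\<Union>w\<in>verts G. R w) B C)"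
      if "u \<in> verts G" "v \<in> verts G" "u \<noteq> v" for u v
      using vis[OF that] adjacent[OF that] by simp
  qed (fact bars)
  then show ?thesis
    by (intro exI[of _ R])
qed

lemma complete_digraph_inj:
  assumes "K\<^bsub>n\<^esub> G" "n \<ge> 1"
  shows "\<exists>f :: 'a \<Rightarrow> int. inj_on f (verts (G :: ('a, 'b) pre_digraph)) \<and> f ` verts G \<subseteq> {0..<int n}"
proof -
  have V: "finite (verts G)" "card (verts G) = n"
    using assms by (auto simp: complete_digraph_def intro: card_ge_0_finite)
  then obtain g where "bij_betw g (verts G) {0..<n}"
    using ex_bij_betw_finite_nat by blast
  then have "inj_on (\<lambda>v. int (g v)) (verts G)" "(\<lambda>v. int (g v)) ` verts G \<subseteq> {0..<int n}"
    by (auto simp: bij_betw_def inj_on_def)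
  then show ?thesis
    by blast
qed

subsection \<open>The tower\<close>

locale tower =
  fixes p :: int
  assumes p_pos: "1 \<le> p"
begin

definition M :: int where "M = 6 * p - 1"

definition side :: "int \<Rightarrow> int" where "side i = (if even i then 1 else - 1)"

text \<open>
  A bar of the tower is a pair \<open>(i, e)\<close>; heights are lexicographic. For \<open>0 \<le> i < M\<close> the bar \<open>(i, 0)\<close>
  is \<open>A\<^sub>i\<close> and the bars \<open>(i, e)\<close> with \<open>0 < e < p\<close> form \<open>C\<^sub>i\<close>, whose label offsets are \<open>D e\<close>. All other
  bars have \<open>e = 0\<close>. The labels \<open>M\<close>, \<open>M + 1\<close>, \<open>M + 2\<close> are the extra vertices \<open>a\<close>, \<open>b\<close>, \<open>c\<close>.
\<close>

definition D :: "int \<Rightarrow> int" where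
  "D e = (if e = 0 then 0
          else if even (p - 1 - e) then 3 * p - 1 - 3 * ((p - 1 - e) div 2)
          else 5 + 3 * ((p - 2 - e) div 2))"

definition Y :: "(int \<times> int) set" where
  "Y = {(i, e). - 4 \<le> i \<and> i \<le> 2 * M + 1 \<and> 0 \<le> e \<and> e < p \<and> (e = 0 \<or> 0 \<le> i \<and> i < M)}"

definition X :: "int \<times> int \<Rightarrow> int" where
  "X = (\<lambda>(i, e).
     if i = - 4 then - 12 * p else if i = - 3 then 12 * p
     else if i = - 2 then 0 else if i = - 1 then 1
     else if i \<le> M + 1 then side i * (if e = 0 then 6 * p + i else e)
     else if i = M + 2 then - 6 * p
     else if i < 2 * M then M + 1 - i
     else if i = 2 * M then - 12 * p else 6 * p)"

definition lab :: "int \<times> int \<Rightarrow> int" where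
  "lab = (\<lambda>(i, e).
     if i = - 4 \<or> i = - 3 then M else if i = - 2 then M + 1 else if i = - 1 then M + 2
     else if i \<le> M + 1 then (i + D e) mod M
     else if i = M + 2 then M + 1
     else if i \<le> 2 * M then i - M - 1 else M + 2)"

definition h :: "int \<times> int \<Rightarrow> int" where
  "h = (\<lambda>(i, e). i * p + e)"

abbreviation adj :: "int \<Rightarrow> int \<Rightarrow> bool" where
  "adj \<equiv> linked Y X h lab"

abbreviation lex_less :: "int \<Rightarrow> int \<Rightarrow> int \<Rightarrow> int \<Rightarrow> bool" where
  "lex_less i e j f \<equiv> i < j \<or> i = j \<and> e < f"

lemma h_less:
  assumes "(i, e) \<in> Y" "(j, f) \<in> Y"
  shows "h (i, e) < h (j, f) \<longleftrightarrow> lex_less i e j f"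
proof -
  have less: "i * p + e < j * p + f" if "i < j" "e < p" "0 \<le> f" for i e j f :: int
  proof -
    have "(i + 1) * p \<le> j * p"
      using that p_pos by (intro mult_right_mono) auto
    then show ?thesis
      using that by (simp add: algebra_simps)
  qed
  show ?thesis
    using less[of i j e f] less[of j i f e] assms by (auto simp: Y_def h_def) (smt (verit))+
qed

lemma inj_on_h: "inj_on h Y"
proof (rule inj_onI, clarify)
  fix i e j f assume "(i, e) \<in> Y" "(j, f) \<in> Y" "h (i, e) = h (j, f)"
  then show "i = j \<and> e = f"
    using h_less[of i e j f] h_less[of j f i e] by auto
qed

lemma finite_Y: "finite Y"
proof (rule finite_subset)
  show "Y \<subseteq> {- 4..2 * M + 1} \<times> {0..<p}"
    by (auto simp: Y_def)
qed simp

text \<open>\<open>\<sigma>\<close> selects the side on which the line of sight passes: right for 1,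
  left for -1. Taking \<open>\<sigma> = side i\<close> later treats both parities of
  \<open>i\<close> at once.\<close>

lemma adjI:
  assumes mem: "(i, e) \<in> Y" "(j, f) \<in> Y" and less: "lex_less i e j f"
    and lab: "lab (i, e) = u" "lab (j, f) = v"
    and \<sigma>: "\<sigma> = 1 \<or> \<sigma> = - 1"
    and clear: "\<And>k g. (k, g) \<in> Y \<Longrightarrow> lex_less i e k g \<Longrightarrow> lex_less k g j f \<Longrightarrow>
      \<sigma> * X (k, g) < \<sigma> * X (i, e) \<and> \<sigma> * X (k, g) < \<sigma> * X (j, f)"
  shows "adj u v"
proof -
  have c: "\<sigma> * X c < \<sigma> * X (i, e) \<and> \<sigma> * X c < \<sigma> * X (j, f)"
    if "c \<in> Y" "h (i, e) < h c" "h c < h (j, f)" for c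
    using that clear[of "fst c" "snd c"] h_less[OF mem(1), of "fst c" "snd c"]
      h_less[OF _ mem(2), of "fst c" "snd c"] by simp
  have "unobstructed Y X h (i, e) (j, f)"
    unfolding unobstructed_def
  proof (intro conjI mem)
    show "h (i, e) < h (j, f)"
      using h_less mem less by blast
    show "(\<forall>c\<in>Y. h (i, e) < h c \<and> h c < h (j, f) \<longrightarrow> max (X (i, e)) (X (j, f)) < X c) \<or>
          (\<forall>c\<in>Y. h (i, e) < h c \<and> h c < h (j, f) \<longrightarrow> X c < min (X (i, e)) (X (j, f)))"
      using \<sigma>
    proof
      assume "\<sigma> = 1"
      with c show ?thesis by (intro disjI2) simp
    next
      assume "\<sigma> = - 1"
      with c show ?thesis by (intro disjI1) simp
    qed
  qed
  then show ?thesis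
    using lab unfolding linked_def by blast
qed

section \<open>Sight lines in the main part\<close>

lemma D_0 [simp]: "D 0 = 0"
  by (simp add: D_def)

lemma mem_Y_main: "0 \<le> i \<Longrightarrow> i < M \<Longrightarrow> 0 \<le> e \<Longrightarrow> e < p \<Longrightarrow> (i, e) \<in> Y"
  by (auto simp: Y_def)

lemma mem_Y_0: "- 4 \<le> i \<Longrightarrow> i \<le> 2 * M + 1 \<Longrightarrow> (i, 0) \<in> Y"
  using p_pos by (auto simp: Y_def)

lemma lab_main: "0 \<le> i \<Longrightarrow> i \<le> M + 1 \<Longrightarrow> lab (i, e) = (i + D e) mod M"
  by (simp add: lab_def)

lemma lab_main_0: "0 \<le> i \<Longrightarrow> i \<le> M + 1 \<Longrightarrow> lab (i, 0) = i mod M"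
  by (simp add: lab_def D_def)

lemma X_main: "0 \<le> i \<Longrightarrow> i \<le> M + 1 \<Longrightarrow> X (i, e) = side i * (if e = 0 then 6 * p + i else e)"
  by (simp add: X_def)

lemma side_Suc [simp]: "side (i + 1) = - side i" "side (1 + i) = - side i"
  by (auto simp: side_def)

lemma side_add_2 [simp]: "side (i + 2) = side i"
  by (auto simp: side_def)

lemma side_square [simp]: "side i * (side i * x) = x"
  by (auto simp: side_def)

lemma side_cases: "side i = 1 \<or> side i = - 1"
  by (auto simp: side_def)

lemma M_ge: "5 \<le> M" "6 * p = M + 1"
  using p_pos by (auto simp: M_def)

lemma adj_chain_step:
  assumes "0 \<le> i" "i < M" "1 \<le> g" "g + 1 < p"
  shows "adj ((i + D g) mod M) ((i + D (g + 1)) mod M)"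
  by (rule adjI[of i g i "g + 1" _ _ 1]) (use assms in \<open>auto simp: lab_main Y_def\<close>)

text \<open>With growing \<open>e\<close> the bars of \<open>C\<^sub>i\<close> shift towards
  \<open>side i\<close>, so the earlier ones leave that side free.\<close>

lemma adj_chain_below:
  assumes "0 \<le> i" "i < M" "1 \<le> e" "e < p"
  shows "adj (i mod M) ((i + D e) mod M)"
  by (rule adjI[of i 0 i e _ _ "side i"])
    (use assms side_cases in \<open>auto simp: lab_main lab_main_0 mem_Y_main X_main mult.assoc\<close>)

text \<open>The later bars of \<open>C\<^sub>i\<close> leave the opposite side free, and
  \<open>A\<^sub>i\<^sub>+\<^sub>1\<close> lies far out there.\<close>

lemma adj_chain_above:
  assumes "0 \<le> i" "i < M" "1 \<le> e" "e < p"
  shows "adj ((i + D e) mod M) ((i + 1) mod M)"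
proof (rule adjI[of i e "i + 1" 0 _ _ "- side i"])
  show "(i + 1, 0) \<in> Y"
    using assms M_ge by (intro mem_Y_0) auto
  fix k g assume kg: "(k, g) \<in> Y" "lex_less i e k g" "lex_less k g (i + 1) 0"
  then have "k = i" "e < g"
    using assms by (auto simp: Y_def)
  then show "- side i * X (k, g) < - side i * X (i, e) \<and> - side i * X (k, g) < - side i * X (i + 1, 0)"
    using assms p_pos by (simp add: X_main)
qed (use assms side_cases in \<open>auto simp: lab_main lab_main_0 mem_Y_main\<close>)

lemma adj_add_2:
  assumes "0 \<le> i" "i < M"
  shows "adj (i mod M) ((i + 2) mod M)"
proof (rule adjI[of i 0 "i + 2" 0 _ _ "side i"])
  show "(i, 0) \<in> Y" "(i + 2, 0) \<in> Y"
    using assms M_ge by (auto intro: mem_Y_0)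
  fix k g assume kg: "(k, g) \<in> Y" "lex_less i 0 k g" "lex_less k g (i + 2) 0"
  then have "k = i \<or> k = i + 1" "0 \<le> g" "g < p" "k = i \<Longrightarrow> 0 < g"
    by (auto simp: Y_def)
  moreover have "X (i + 2, 0) = side i * (6 * p + i + 2)"
    using assms by (simp add: X_main)
  ultimately show "side i * X (k, g) < side i * X (i, 0) \<and> side i * X (k, g) < side i * X (i + 2, 0)"
    using assms p_pos by (auto simp: X_main)
qed (use assms side_cases in \<open>auto simp: lab_main_0\<close>)

text \<open>No bar of \<open>C\<^sub>i\<close> is left above, while
  \<open>A\<^sub>i\<^sub>+\<^sub>1\<close> and \<open>C\<^sub>i\<^sub>+\<^sub>1\<close> are on the
  opposite side.\<close>

lemma adj_chain_top:
  assumes "0 \<le> i" "i < M" "2 \<le> p"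
  shows "adj ((i + D (p - 1)) mod M) ((i + 2) mod M)"
proof (rule adjI[of i "p - 1" "i + 2" 0 _ _ "side i"])
  show "(i + 2, 0) \<in> Y"
    using assms M_ge by (auto intro: mem_Y_0)
  fix k g assume kg: "(k, g) \<in> Y" "lex_less i (p - 1) k g" "lex_less k g (i + 2) 0"
  then have "k = i + 1" "0 \<le> g" "g < p"
    by (auto simp: Y_def)
  then show "side i * X (k, g) < side i * X (i, p - 1) \<and> side i * X (k, g) < side i * X (i + 2, 0)"
    using assms by (auto simp: X_main)
qed (use assms side_cases in \<open>auto simp: lab_main lab_main_0 mem_Y_main\<close>)

section \<open>The final staircase and the extra vertices\<close>

lemma adj_consecutive:
  assumes "- 4 \<le> i" "i \<le> 2 * M" "i < 0 \<or> M \<le> i"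
  shows "adj (lab (i, 0)) (lab (i + 1, 0))"
proof (rule adjI[of i 0 "i + 1" 0 _ _ 1])
  show "(i, 0) \<in> Y" "(i + 1, 0) \<in> Y"
    using assms M_ge by (auto intro: mem_Y_0)
  fix k g assume "(k, g) \<in> Y" "lex_less i 0 k g" "lex_less k g (i + 1) 0"
  then show "1 * X (k, g) < 1 * X (i, 0) \<and> 1 * X (k, g) < 1 * X (i + 1, 0)"
    using assms by (auto simp: Y_def)
qed auto

lemma Y_outer: "(k, g) \<in> Y \<Longrightarrow> k < 0 \<or> M \<le> k \<Longrightarrow> g = 0"
  by (auto simp: Y_def)

lemma M_odd: "odd M"
  by (simp add: M_def)

lemma side_M [simp]: "side M = - 1"
  using M_odd by (simp add: side_def)

lemma X_outer:
  "X (- 4, 0) = - 12 * p" "X (- 3, 0) = 12 * p" "X (- 2, 0) = 0" "X (- 1, 0) = 1"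
  "X (M, 0) = - (6 * p + M)" "X (M + 1, 0) = 6 * p + M + 1" "X (M + 2, 0) = - 6 * p"
  "M + 2 < k \<Longrightarrow> k < 2 * M \<Longrightarrow> X (k, 0) = M + 1 - k"
  "X (2 * M, 0) = - 12 * p" "X (2 * M + 1, 0) = 6 * p"
  using M_ge by (auto simp: X_def)

lemma lab_outer:
  "lab (- 4, 0) = M" "lab (- 3, 0) = M" "lab (- 2, 0) = M + 1" "lab (- 1, 0) = M + 2"
  "lab (M, 0) = 0" "lab (M + 1, 0) = 1" "lab (M + 2, 0) = M + 1"
  "M + 2 < k \<Longrightarrow> k \<le> 2 * M \<Longrightarrow> lab (k, 0) = k - M - 1"
  "lab (2 * M + 1, 0) = M + 2"
  using M_ge by (auto simp: lab_def D_def)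

lemma adj_outerI:
  assumes ij: "- 4 \<le> i" "i < j" "j \<le> 2 * M + 1" "j < 0 \<or> M \<le> i"
    and \<sigma>: "\<sigma> = 1 \<or> \<sigma> = - 1"
    and clear: "\<And>k. i < k \<Longrightarrow> k < j \<Longrightarrow> \<sigma> * X (k, 0) < \<sigma> * X (i, 0) \<and> \<sigma> * X (k, 0) < \<sigma> * X (j, 0)"
  shows "adj (lab (i, 0)) (lab (j, 0))"
proof (rule adjI[of i 0 j 0 _ _ \<sigma>])
  show "(i, 0) \<in> Y" "(j, 0) \<in> Y"
    using ij M_ge by (auto intro: mem_Y_0)
  fix k g assume kg: "(k, g) \<in> Y" "lex_less i 0 k g" "lex_less k g j 0"
  then have "g = 0" "i < k" "k < j"
    using ij Y_outer[OF kg(1)] by (auto simp: Y_def)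
  then show "\<sigma> * X (k, g) < \<sigma> * X (i, 0) \<and> \<sigma> * X (k, g) < \<sigma> * X (j, 0)"
    using clear by simp
qed (use ij \<sigma> in auto)

lemma adj_cycle:
  assumes "0 \<le> x" "x < M"
  shows "adj x ((x + 1) mod M)"
proof -
  consider "x = 0" | "x = 1" | "2 \<le> x" "x \<le> M - 2" | "x = M - 1"
    using assms by linarith
  then show ?thesis
  proof cases
    case 1
    then show ?thesis
      using adj_consecutive[of M] M_ge by (simp add: lab_outer)
  next
    case 2
    \<comment> \<open>The bar of \<open>b\<close> at \<open>M + 2\<close> is in between, but further
      left than both.\<close>
    have "adj (lab (M + 1, 0)) (lab (M + 3, 0))"
    proof (rule adj_outerI[where \<sigma> = 1])
      fix k assume "M + 1 < k" "k < M + 3"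
      then have "k = M + 2" by simp
      then show "1 * X (k, 0) < 1 * X (M + 1, 0) \<and> 1 * X (k, 0) < 1 * X (M + 3, 0)"
        using M_ge X_outer(8)[of "M + 3"] by (simp add: X_outer)
    qed (use M_ge in auto)
    then show ?thesis
      using 2 M_ge lab_outer(8)[of "M + 3"] by (simp add: lab_outer)
  next
    case 3
    then show ?thesis
      using adj_consecutive[of "M + 1 + x"] M_ge
        lab_outer(8)[of "M + 1 + x"] lab_outer(8)[of "M + 1 + x + 1"] by (simp add: algebra_simps)
  next
    case 4
    \<comment> \<open>Closing the cycle: both bars are further left than everything between
      them.\<close>
    have "adj (lab (M, 0)) (lab (2 * M, 0))"
    proof (rule adj_outerI[where \<sigma> = "- 1"])
      fix k assume k: "M < k" "k < 2 * M"
      have "k = M + 1 \<or> k = M + 2 \<or> M + 2 < k \<and> k < 2 * M"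
        using k by linarith
      then show "- 1 * X (k, 0) < - 1 * X (M, 0) \<and> - 1 * X (k, 0) < - 1 * X (2 * M, 0)"
        using M_ge by (elim disjE) (auto simp: X_outer)
    qed (use M_ge in auto)
    then show ?thesis
      using 4 M_ge lab_outer(8)[of "2 * M"] linked_commute by (simp add: lab_outer)
  qed
qed

lemma adj_a:
  assumes "0 \<le> x" "x < M"
  shows "adj M x"
proof -
  \<comment> \<open>This is the bar of \<open>a\<close> on the same side as
    \<open>A\<^sub>x\<close>. For odd \<open>x\<close> the other bar of \<open>a\<close> is in
    between, but on the opposite side.\<close>
  let ?i = "if even x then - 3 else - 4 :: int"
  have X_le: "side x * X (k, g) < 6 * p + x" if k: "(k, g) \<in> Y" "- 2 \<le> k" "lex_less k g x 0" for k g
  proof -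
    have "k < x" "0 \<le> g" "g < p"
      using k by (auto simp: Y_def)
    then consider "k = - 2 \<or> k = - 1" | "0 \<le> k" "k < x" "0 \<le> g" "g < p"
      using k(2) by linarith
    then show ?thesis
    proof cases
      case 1
      then show ?thesis
        using Y_outer[OF k(1)] assms M_ge by (auto simp: X_outer side_def)
    next
      case 2
      then show ?thesis
        using assms M_ge by (auto simp: X_main side_def)
    qed
  qed
  have x: "X (x, 0) = side x * (6 * p + x)"
    using assms M_ge by (simp add: X_main)
  show ?thesis
  proof (rule adjI[of ?i 0 x 0 _ _ "side x"])
    fix k g assume kg: "(k, g) \<in> Y" "lex_less ?i 0 k g" "lex_less k g x 0"
    show "side x * X (k, g) < side x * X (?i, 0) \<and> side x * X (k, g) < side x * X (x, 0)"
    proof (cases "- 2 \<le> k")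
      case True
      then show ?thesis
        using X_le[OF kg(1) True kg(3)] assms M_ge unfolding x by (auto simp: X_outer side_def)
    next
      case False
      then have "k = - 3" "g = 0" "odd x"
        using kg Y_outer[OF kg(1)] by (auto simp: Y_def split: if_splits)
      then show ?thesis
        using assms M_ge unfolding x by (auto simp: X_outer side_def)
    qed
  qed (use assms M_ge side_cases in \<open>auto simp: lab_outer lab_main_0 intro: mem_Y_0\<close>)
qed

lemma adj_b:
  assumes "0 \<le> x" "x < M"
  shows "adj (M + 1) x"
proof -
  consider "x = 0" | "x = 1" | "2 \<le> x"
    using assms by linarith
  then show ?thesis
  proof cases
    case 1
    have "adj (lab (M, 0)) (lab (M + 2, 0))"
    proof (rule adj_outerI[where \<sigma> = "- 1"])
      fix k assume "M < k" "k < M + 2"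
      then have "k = M + 1" by simp
      then show "- 1 * X (k, 0) < - 1 * X (M, 0) \<and> - 1 * X (k, 0) < - 1 * X (M + 2, 0)"
        using M_ge by (simp add: X_outer)
    qed (use M_ge in auto)
    then show ?thesis
      using 1 linked_commute by (simp add: lab_outer)
  next
    case 2
    have "adj (lab (M + 1, 0)) (lab (M + 2, 0))"
      using adj_consecutive[of "M + 1"] M_ge by (simp add: algebra_simps)
    then show ?thesis
      using 2 linked_commute by (simp add: lab_outer)
  next
    case 3
    have "adj (lab (M + 2, 0)) (lab (M + 1 + x, 0))"
    proof (rule adj_outerI[where \<sigma> = "- 1"])
      fix k assume "M + 2 < k" "k < M + 1 + x"
      then show "- 1 * X (k, 0) < - 1 * X (M + 2, 0) \<and> - 1 * X (k, 0) < - 1 * X (M + 1 + x, 0)"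
        using M_ge assms by (cases "x = M - 1") (auto simp: X_outer)
    qed (use M_ge 3 assms in auto)
    then show ?thesis
      using 3 assms lab_outer(8)[of "M + 1 + x"] by (simp add: lab_outer)
  qed
qed

lemma adj_c:
  assumes "0 \<le> x" "x < M"
  shows "adj (M + 2) x"
proof (cases "x = 0")
  case True
  then show ?thesis
    using adj_consecutive[of "- 1"] M_ge by (simp add: lab_outer lab_main_0)
next
  case False
  \<comment> \<open>The bar of \<open>b\<close> at \<open>M + 2\<close> interrupts the final
    staircase, so labels from 2 on are shifted by one position.\<close>
  let ?i = "if x = 1 then M + 1 else M + 1 + x"
  have "adj (lab (?i, 0)) (lab (2 * M + 1, 0))"
  proof (rule adj_outerI[where \<sigma> = 1])
    fix k assume k: "?i < k" "k < 2 * M + 1"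
    then have "M < k"
      using False assms by (auto split: if_splits)
    then have "k = M + 1 \<or> k = M + 2 \<or> M + 2 < k \<and> k < 2 * M \<or> k = 2 * M"
      using k(2) by linarith
    then show "1 * X (k, 0) < 1 * X (?i, 0) \<and> 1 * X (k, 0) < 1 * X (2 * M + 1, 0)"
      using k M_ge assms False
      by (elim disjE) (auto simp: X_outer split: if_splits)
  qed (use M_ge False assms in auto)
  moreover have "lab (?i, 0) = x"
    using False assms lab_outer(8)[of "M + 1 + x"] by (auto simp: lab_outer)
  ultimately show ?thesis
    using linked_commute by (simp add: lab_outer)
qed

lemma adj_abc: "adj M (M + 1)" "adj (M + 1) (M + 2)" "adj M (M + 2)"
proof -
  show "adj M (M + 1)"
    using adj_consecutive[of "- 3"] M_ge by (simp add: lab_outer)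
  show "adj (M + 1) (M + 2)"
    using adj_consecutive[of "- 2"] M_ge by (simp add: lab_outer)
  have "adj (lab (- 3, 0)) (lab (- 1, 0))"
  proof (rule adj_outerI[where \<sigma> = 1])
    fix k :: int assume "- 3 < k" "k < - 1"
    then have "k = - 2" by simp
    then show "1 * X (k, 0) < 1 * X (- 3, 0) \<and> 1 * X (k, 0) < 1 * X (- 1, 0)"
      using p_pos by (simp add: X_outer)
  qed (use M_ge in auto)
  then show "adj M (M + 2)"
    by (simp add: lab_outer)
qed

section \<open>Zigzag offsets and label differences\<close>

lemma D_surj:
  assumes "0 \<le> w" "w \<le> p - 2"
  shows "\<exists>e. 1 \<le> e \<and> e < p \<and> D e = 5 + 3 * w"
\<comment> \<open>Small offsets occur at odd distance from the top of the zigzag, large ones at even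
  distance; each witness inverts the matching branch of \<open>D\<close>.\<close>
proof (cases "2 * w \<le> p - 3")
  case True
  then show ?thesis
    using assms by (intro exI[of _ "p - 2 - 2 * w"]) (auto simp: D_def)
next
  case False
  then show ?thesis
    using assms by (intro exI[of _ "2 * w - p + 3"]) (auto simp: D_def)
qed

lemma D_top: "2 \<le> p \<Longrightarrow> D (p - 1) = 3 * p - 1"
  by (simp add: D_def)

text \<open>The zigzag is a graceful labelling of a path, scaled by 3: alternating between the
  largest and smallest remaining values makes each difference 3 less than the previous one, going
  down from the top.\<close>

lemma D_step:
  assumes "1 \<le> g" "g \<le> p - 2"
  shows "\<bar>D (g + 1) - D g\<bar> = 3 * g"
proof (cases "even (p - g)")
  case True
  then obtain k where k: "p - g = 2 * k" ..
  then have e: "p - 1 - (g + 1) = 2 * (k - 1)" "p - 1 - g = 2 * (k - 1) + 1" "p - 2 - g = 2 * (k - 1)"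
    by auto
  show ?thesis
    unfolding D_def e using k assms by simp
next
  case False
  then obtain k where k: "p - g = 2 * k + 1" ..
  then have e: "p - 1 - (g + 1) = 2 * (k - 1) + 1" "p - 1 - g = 2 * k" "p - 2 - (g + 1) = 2 * (k - 1)"
    by auto
  show ?thesis
    unfolding D_def e using k assms by simp
qed

text \<open>Sorted by \<open>d mod 3\<close>: residue 2 comes from \<open>A\<^sub>i\<close> below
  \<open>C\<^sub>i\<close>, residue 1 from \<open>A\<^sub>i\<^sub>+\<^sub>1\<close> above it,
  residue 0 from steps of the zigzag and its top bar. The differences 1 and 2 come from the final
  cycle and from \<open>A\<^sub>i\<close>, \<open>A\<^sub>i\<^sub>+\<^sub>2\<close>.\<close>

lemma adj_difference:
  assumes x: "0 \<le> x" "x < M" and d: "1 \<le> d" "d \<le> 3 * p - 1"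
  shows "adj x ((x + d) mod M)"
proof -
  have M_pos: "M > 0"
    using M_ge by simp
  have mod: "0 \<le> z mod M" "z mod M < M" for z
    using M_pos by auto
  consider "d = 1" | "d = 2" | w where "0 \<le> w" "w \<le> p - 2" "d = 5 + 3 * w"
    | w where "0 \<le> w" "w \<le> p - 2" "d = 4 + 3 * w" | "d = 3 * (p - 1)"
    | g where "1 \<le> g" "g \<le> p - 2" "d = 3 * g"
  proof -
    have "d = 3 * (d div 3) + d mod 3" "d mod 3 = 0 \<or> d mod 3 = 1 \<or> d mod 3 = 2"
      by auto
    then show ?thesis
      using that(1,2) that(3)[of "d div 3 - 1"] that(4)[of "d div 3 - 1"] that(5) that(6)[of "d div 3"] d
      by (smt (verit))
  qed
  then show ?thesis
  proof cases
    case 1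
    then show ?thesis using adj_cycle x by simp
  next
    case 2
    then show ?thesis using adj_add_2[OF x] x by simp
  next
    case (3 w)
    then obtain e where "1 \<le> e" "e < p" "D e = d"
      using D_surj by blast
    then show ?thesis
      using adj_chain_below[OF x, of e] x by simp
  next
    case (4 w)
    then obtain e where e: "1 \<le> e" "e < p" "D e = d + 1"
      using D_surj[of w] by auto
    have "adj (((x - 1) mod M + D e) mod M) (((x - 1) mod M + 1) mod M)"
      using adj_chain_above[OF mod] e by blast
    then show ?thesis
      using x e linked_commute by (simp add: mod_simps)
  next
    case 5
    have "adj (((x - 2) mod M + D (p - 1)) mod M) (((x - 2) mod M + 2) mod M)"
      using adj_chain_top[OF mod] 5 d by simp
    then have "adj ((x - 2 + D (p - 1)) mod M) ((x - 2 + 2) mod M)"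
      by (simp only: mod_add_left_eq)
    moreover have "x - 2 + D (p - 1) = x + d"
      using 5 d D_top by simp
    ultimately show ?thesis
      using x linked_commute by simp
  next
    case (6 g)
    have *: "adj ((z mod M + D g) mod M) ((z mod M + D (g + 1)) mod M)" for z
      using adj_chain_step[OF mod] 6 by simp
    \<comment> \<open>The zigzag may go up or down here; the base is chosen so that the smaller
      offset lands on \<open>x\<close>.\<close>
    from D_step[of g] 6 consider "D (g + 1) = D g + d" | "D g = D (g + 1) + d"
      by linarith
    then show ?thesis
    proof cases
      case 1
      then show ?thesis
        using *[of "x - D g"] x by (simp add: mod_simps)
    next
      case 2
      then show ?thesis
        using linked_commute[OF *[of "x - D (g + 1)"]] x by (simp add: mod_simps)
    qed
  qed
qed

lemma adj_all:
  assumes "0 \<le> u" "u < M + 3" "0 \<le> v" "v < M + 3" "u \<noteq> v"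
  shows "adj u v"
  using assms
proof (induction u v rule: linorder_wlog)
  case (le u v)
  show ?case
  proof (cases "v < M")
    case True
    show ?thesis
    proof (cases "v - u \<le> 3 * p - 1")
      case True
      then show ?thesis
        using adj_difference[of u "v - u"] le \<open>v < M\<close> by simp
    next
      case False
      \<comment> \<open>As \<open>M = 2 * (3 * p - 1) + 1\<close>, going round the other way gives a
        difference of at most \<open>3 * p - 1\<close>.\<close>
      then have "adj v ((v + (M - (v - u))) mod M)"
        using le \<open>v < M\<close> by (intro adj_difference) (auto simp: M_def)
      moreover have "(v + (M - (v - u))) mod M = u"
        using le \<open>v < M\<close> by simp
      ultimately show ?thesis
        using linked_commute by metis
    qed
  next
    case False
    then have v: "v = M \<or> v = M + 1 \<or> v = M + 2"
      using le by auto
    show ?thesis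
    proof (cases "u < M")
      case True
      then have "adj M u" "adj (M + 1) u" "adj (M + 2) u"
        using le adj_a adj_b adj_c by auto
      then show ?thesis
        using v linked_commute by metis
    next
      case False
      then have "u = M \<or> u = M + 1"
        using le v by linarith
      then show ?thesis
        using v le adj_abc by auto
    qed
  qed
next
  case (sym u v)
  then show ?case
    using linked_commute by metis
qed

section \<open>Bars per label and the upper bound\<close>

lemma card_label:
  assumes "0 \<le> z" "z < M + 3"
  shows "card {c \<in> Y. lab c = z} \<le> nat (p + 1)"
proof -
  have card_2: "card {c \<in> Y. lab c = z} \<le> nat (p + 1)" if "{c \<in> Y. lab c = z} \<subseteq> {c, d}" for c d
  proof -
    have "card {c \<in> Y. lab c = z} \<le> card {c, d}"
      using that by (intro card_mono) auto
    also have "\<dots> \<le> 2"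
      by (simp add: card_insert_if)
    finally show ?thesis
      using p_pos by simp
  qed
  have lab_less: "lab (i, e) < M" if "0 \<le> i" "i \<le> 2 * M" "i \<noteq> M + 2" for i e
    using that M_ge by (auto simp: lab_def)
  have cases: "0 \<le> i \<and> i \<le> 2 * M \<and> i \<noteq> M + 2 \<or> e = 0 \<and> i \<in> {- 4, - 3, - 2, - 1, M + 2, 2 * M + 1}"
    if "(i, e) \<in> Y" for i e
    using that Y_outer[OF that] M_ge by (auto simp: Y_def)
  have outer: "\<exists>i. c = (i, 0) \<and> lab (i, 0) = z \<and> i \<in> {- 4, - 3, - 2, - 1, M + 2, 2 * M + 1}"
    if c: "c \<in> {c \<in> Y. lab c = z}" "M \<le> z" for c
  proof -
    obtain i e where "c = (i, e)" "(i, e) \<in> Y" "lab (i, e) = z"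
      using c(1) by (cases c) auto
    then show ?thesis
      using cases[of i e] lab_less[of i e] c(2) by force
  qed
  consider "z < M" | "z = M" | "z = M + 1" | "z = M + 2"
    using assms by linarith
  then show ?thesis
  proof cases
    case 1
    \<comment> \<open>For each of the \<open>p\<close> values of \<open>e\<close> exactly one base
      \<open>i\<close> in the main part gives the label \<open>z\<close>; the inserted bar is its
      repetition in the final staircase.\<close>
    let ?S = "insert (if z < 2 then M + z else M + 1 + z, 0) ((\<lambda>e. ((z - D e) mod M, e)) ` {0..<p})"
    have "{c \<in> Y. lab c = z} \<subseteq> ?S"
    proof
      fix c assume "c \<in> {c \<in> Y. lab c = z}"
      then obtain i e where ie: "c = (i, e)" "(i, e) \<in> Y" "lab (i, e) = z"
        by (cases c) auto
      show "c \<in> ?S"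
      proof (cases "0 \<le> i \<and> i < M")
        case True
        then have "z = (i + D e) mod M"
          using ie(3) by (simp add: lab_main)
        then have "i = (z - D e) mod M"
          using True by (simp add: mod_simps)
        then show ?thesis
          using ie(1,2) by (auto simp: Y_def)
      next
        case False
        then have "e = 0" "i = M \<or> i = M + 1 \<or> M + 2 < i \<and> i \<le> 2 * M"
          using ie(2,3) cases[OF ie(2)] Y_outer[OF ie(2)] 1 M_ge by (auto simp: lab_outer)
        then show ?thesis
          using ie(1,3) by (elim disjE) (auto simp: lab_outer)
      qed
    qed
    then have "card {c \<in> Y. lab c = z} \<le> card ?S"
      by (intro card_mono) auto
    also have "\<dots> \<le> Suc (card ((\<lambda>e. ((z - D e) mod M, e)) ` {0..<p}))"
      by (rule card_insert_le_m1) auto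
    also have "\<dots> \<le> Suc (card {0..<p})"
      using card_image_le[of "{0..<p}"] by simp
    finally show ?thesis
      using p_pos by simp
  next
    case 2
    have "{c \<in> Y. lab c = z} \<subseteq> {(- 4, 0), (- 3, 0)}"
    proof
      fix c assume "c \<in> {c \<in> Y. lab c = z}"
      from outer[OF this] 2 show "c \<in> {(- 4, 0), (- 3, 0)}"
        by (auto simp: lab_outer)
    qed
    then show ?thesis by (rule card_2)
  next
    case 3
    have "{c \<in> Y. lab c = z} \<subseteq> {(- 2, 0), (M + 2, 0)}"
    proof
      fix c assume "c \<in> {c \<in> Y. lab c = z}"
      from outer[OF this] 3 show "c \<in> {(- 2, 0), (M + 2, 0)}"
        by (auto simp: lab_outer)
    qed
    then show ?thesis by (rule card_2)
  next
    case 4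
    have "{c \<in> Y. lab c = z} \<subseteq> {(- 1, 0), (2 * M + 1, 0)}"
    proof
      fix c assume "c \<in> {c \<in> Y. lab c = z}"
      from outer[OF this] 4 show "c \<in> {(- 1, 0), (2 * M + 1, 0)}"
        by (auto simp: lab_outer)
    qed
    then show ?thesis by (rule card_2)
  qed
qed

lemma label_used:
  assumes "0 \<le> z" "z < M + 3"
  shows "z \<in> lab ` Y"
proof -
  have "adj z (if z = 0 then 1 else 0)"
    using assms M_ge by (intro adj_all) auto
  then show ?thesis
    unfolding linked_def unobstructed_def by blast
qed

lemma complete_rep:
  assumes K: "K\<^bsub>n\<^esub> G" and "n \<ge> 1" and n: "int n \<le> 6 * p + 2"
  shows "\<exists>R. unit_bar_visibility_rep (nat (p + 1)) G R"
proof -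
  obtain f :: "'a \<Rightarrow> int" where f: "inj_on f (verts G)" "f ` verts G \<subseteq> {0..<int n}"
    using complete_digraph_inj[OF K \<open>n \<ge> 1\<close>] by blast
  then have f_range: "0 \<le> f v \<and> f v < M + 3" if "v \<in> verts G" for v
    using that n M_ge by force
  show ?thesis
  proof (rule complete_rep_of_stack[OF K finite_Y inj_on_h f(1)])
    show "adj (f u) (f v)" if "u \<in> verts G" "v \<in> verts G" "u \<noteq> v" for u v
      using that f(1) f_range by (intro adj_all) (auto dest: inj_onD)
    show "f v \<in> lab ` Y" "card {c \<in> Y. lab c = f v} \<le> nat (p + 1)" if "v \<in> verts G" for v
      using f_range[OF that] label_used card_label by blast+
  qed
qed

end

text \<open>The tower needs \<open>p \<ge> 1\<close>; this is the remaining case, with one bar per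
  vertex.\<close>

lemma complete_rep_1:
  assumes K: "K\<^bsub>n\<^esub> G" and "n \<ge> 1" "n \<le> 2"
  shows "\<exists>R. unit_bar_visibility_rep 1 G R"
proof -
  obtain f :: "'a \<Rightarrow> int" where f: "inj_on f (verts G)" "f ` verts G \<subseteq> {0..<int n}"
    using complete_digraph_inj[OF K \<open>n \<ge> 1\<close>] by blast
  then have f_range: "f v = 0 \<or> f v = 1" if "v \<in> verts G" for v
    using that \<open>n \<le> 2\<close> by force
  have "linked {0, 1} (\<lambda>_. 0) (\<lambda>i. i) (\<lambda>i. i) 0 (1 :: int)"
    unfolding linked_def unobstructed_def by (intro exI[of _ 0] exI[of _ 1]) auto
  from this linked_commute[OF this] have linked: "linked {0, 1} (\<lambda>_. 0) (\<lambda>i. i) (\<lambda>i. i) i j"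
    if "i = 0 \<or> i = 1" "j = 0 \<or> j = 1" "i \<noteq> j" for i j :: int
    using that by auto
  show ?thesis
  proof (rule complete_rep_of_stack[OF K _ _ f(1)])
    fix u v assume "u \<in> verts G" "v \<in> verts G" "u \<noteq> v"
    then show "linked {0, 1} (\<lambda>_. 0) (\<lambda>i. i) (\<lambda>i. i) (f u) (f v)"
      using f(1) f_range by (intro linked) (auto dest: inj_onD)
  next
    fix v assume "v \<in> verts G"
    then have "{i \<in> {0, 1}. i = f v} = {f v}"
      using f_range by auto
    then show "card {i \<in> {0, 1}. i = f v} \<le> 1"
      by simp
  qed (use f_range in auto)
qed

theorem theorem23:
  fixes n :: nat and G :: "('a,'b) pre_digraph"
  assumes "n \<ge> 1" and "K\<^bsub>n\<^esub> G"
  shows "\<lceil>real n / 6\<rceil> \<le> int (ub G) \<and> int (ub G) \<le> \<lceil>(real n + 4) / 6\<rceil>"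
proof -
  define c where "c = \<lceil>(real n + 4) / 6\<rceil>"
  have "(real n + 4) / 6 \<le> c"
    by (simp add: c_def)
  then have "real n \<le> 6 * real_of_int c - 4"
    by simp
  then have "real_of_int (int n) \<le> real_of_int (6 * (c - 1) + 2)"
    by simp
  \<comment> \<open>This is the capacity of the tower with \<open>p = c - 1\<close>, which uses
    \<open>p + 1 = c\<close> bars per vertex.\<close>
  then have n_le: "int n \<le> 6 * (c - 1) + 2"
    by (simp only: of_int_le_iff)
  moreover have "1 \<le> int n"
    using assms(1) by simp
  ultimately have "1 \<le> c"
    by presburger
  have ex: "\<exists>R. unit_bar_visibility_rep (nat c) G R"
  proof (cases "c = 1")
    case True
    then show ?thesis
      using complete_rep_1[OF assms(2,1)] n_le by simp
  next
    case False
    then interpret tower "c - 1"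
      using \<open>1 \<le> c\<close> by unfold_locales simp
    show ?thesis
      using complete_rep[OF assms(2,1)] n_le by simp
  qed
  then have "ub G \<le> nat c"
    unfolding ub_def by (rule Least_le)
  moreover have "\<exists>R. unit_bar_visibility_rep (ub G) G R"
    unfolding ub_def using ex by (rule LeastI)
  then have "n \<le> 6 * ub G"
    using rep_complete_imp_le assms by blast
  ultimately show ?thesis
    using \<open>1 \<le> c\<close> by (auto simp: c_def[symmetric] ceiling_le_iff)
qed

end
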